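(* Let $\mathcal{V}$ be a monoidal category, let $\mathcal{A}$ and $\mathcal{X}$ be $\mathcal{V}$-categories, and let $(U,F,\pi)$ be an adjunction core between them, i.e. functions $U:\mathrm{ob}\,\mathcal{A}\to\mathrm{ob}\,\mathcal{X}$ and $F:\mathrm{ob}\,\mathcal{X}\to\mathrm{ob}\,\mathcal{A}$ together with a family of isomorphisms $\pi=\pi_{X,A}:\mathcal{A}(FX,A)\cong\mathcal{X}(X,UA)$ in $\mathcal{V}$ indexed by $A\in\mathcal{A}$, $X\in\mathcal{X}$ (no naturality assumed). Let $U_{A,B}:\mathcal{A}(A,B)\to\mathcal{X}(UA,UB)$ and $F_{X,Y}:\mathcal{X}(X,Y)\to\mathcal{A}(FX,FY)$ be the morphisms of $\mathcal{V}$ constructed from the core as in the context. Then the adjunction core extends to an adjunction $\pi:F\dashv U:\mathcal{A}\to\mathcal{X}$ if and only if at least one of the following two conditions holds: (I) for all $A,B\in\mathcal{A}$ and $X\in\mathcal{X}$, $$\mathrm{comp}\circ(U_{A,B}\otimes\pi_{X,A})=\pi_{X,B}\circ\mathrm{comp}:\ \mathcal{A}(A,B)\otimes\mathcal{A}(FX,A)\longrightarrow\mathcal{X}(X,UB);$$ (II) for all $A\in\mathcal{A}$ and $X,Y\in\mathcal{X}$, $$\mathrm{comp}\circ(\pi_{Y,A}^{-1}\otimes F_{X,Y})=\pi_{X,A}^{-1}\circ\mathrm{comp}:\ \mathcal{X}(Y,UA)\otimes\mathcal{X}(X,Y)\longrightarrow\mathcal{A}(FX,A).$$ The adjunction is unique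 when it exists.
   Context: $\mathcal{V}$-categories are in the sense of Eilenberg--Kelly, with composition $\mathrm{comp}:\mathcal{A}(B,C)\otimes\mathcal{A}(A,B)\to\mathcal{A}(A,C)$ and identities $j:I\to\mathcal{A}(A,A)$. An adjunction $\pi:F\dashv U:\mathcal{A}\to\mathcal{X}$ consists of $\mathcal{V}$-functors $U:\mathcal{A}\to\mathcal{X}$ and $F:\mathcal{X}\to\mathcal{A}$ and a family of isomorphisms $\pi_{X,A}:\mathcal{A}(FX,A)\cong\mathcal{X}(X,UA)$ in $\mathcal{V}$ which is $\mathcal{V}$-natural in $A$ and in $X$; that is, writing $U_{A,B}$ and $F_{X,Y}$ for the effects on homs of the $\mathcal{V}$-functors, $\mathrm{comp}\circ(U_{A,B}\otimes\pi_{X,A})=\pi_{X,B}\circ\mathrm{comp}$ on $\mathcal{A}(A,B)\otimes\mathcal{A}(FX,A)$ and $\mathrm{comp}\circ(\pi_{Y,A}\otimes 1)=\pi_{X,A}\circ\mathrm{comp}\circ(1\otimes F_{X,Y})$ on $\mathcal{A}(FY,A)\otimes\mathcal{X}(X,Y)$. An adjunction core extends to an adjunction if there are $\mathcal{V}$-functors with the given object functions $U,F$ for which the given $\pi$ is such a $\mathcal{V}$-natural family; uniqueness means the effects of these $\mathcal{V}$-functors on homs are uniquely determined by the core. Constructions from a core $(U,F,\pi)$: (a) $\beta_X:I\to\mathcal{X}(X,UFX)$ is the composite $I\xrightarrow{j}\mathcal{A}(FX,FX)\xrightarrow{\pi}\mathcal{X}(X,UFX)$. (b) $\alpha_A:I\to\mathcal{A}(FUA,A)$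 is the composite $I\xrightarrow{j}\mathcal{X}(UA,UA)\xrightarrow{\pi^{-1}}\mathcal{A}(FUA,A)$. (c) $U_{A,B}$ is the composite $\mathcal{A}(A,B)\xrightarrow{\mathcal{A}(\alpha_A,1)}\mathcal{A}(FUA,B)\xrightarrow{\pi}\mathcal{X}(UA,UB)$, where $\mathcal{A}(\alpha_A,1)$ is $\mathcal{A}(A,B)\cong\mathcal{A}(A,B)\otimes I\xrightarrow{1\otimes\alpha_A}\mathcal{A}(A,B)\otimes\mathcal{A}(FUA,A)\xrightarrow{\mathrm{comp}}\mathcal{A}(FUA,B)$. (d) $F_{X,Y}$ is the composite $\mathcal{X}(X,Y)\xrightarrow{\mathcal{X}(1,\beta_Y)}\mathcal{X}(X,UFY)\xrightarrow{\pi^{-1}}\mathcal{A}(FX,FY)$, where $\mathcal{X}(1,\beta_Y)$ is $\mathcal{X}(X,Y)\cong I\otimes\mathcal{X}(X,Y)\xrightarrow{\beta_Y\otimes1}\mathcal{X}(Y,UFY)\otimes\mathcal{X}(X,Y)\xrightarrow{\mathrm{comp}}\mathcal{X}(X,UFY)$. *)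

theory Defs
  imports "HOL-Library.FuncSet"
begin

section \<open>Categories\<close>

record ('o, 'm) category =
  Ob :: "'o set"
  Arr :: "'m set"
  Dom :: "'m \<Rightarrow> 'o"
  Cod :: "'m \<Rightarrow> 'o"
  Ident :: "'o \<Rightarrow> 'm"
  Comp :: "'m \<Rightarrow> 'm \<Rightarrow> 'm"  (infixr "\<cdot>\<index>" 60)

definition hom :: "('o, 'm, 'z) category_scheme \<Rightarrow> 'o \<Rightarrow> 'o \<Rightarrow> 'm set" where
  "hom C a b = {f \<in> Arr C. Dom C f = a \<and> Cod C f = b}"

text \<open>Composition is written in applicative order and is constrained only on composable arrows.\<close>

locale category =
  fixes C :: "('o, 'm, 'z) category_scheme" (structure)
  assumes Dom_Ob: "f \<in> Arr C \<Longrightarrow> Dom C f \<in> Ob C"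
    and Cod_Ob: "f \<in> Arr C \<Longrightarrow> Cod C f \<in> Ob C"
    and Ident_hom: "a \<in> Ob C \<Longrightarrow> Ident C a \<in> hom C a a"
    and Comp_hom: "\<lbrakk>f \<in> hom C a b; g \<in> hom C b c\<rbrakk> \<Longrightarrow> g \<cdot> f \<in> hom C a c"
    and Comp_Ident: "f \<in> hom C a b \<Longrightarrow> f \<cdot> Ident C a = f"
    and Ident_Comp: "f \<in> hom C a b \<Longrightarrow> Ident C b \<cdot> f = f"
    and Comp_assoc:
      "\<lbrakk>f \<in> hom C a b; g \<in> hom C b c; h \<in> hom C c d\<rbrakk> \<Longrightarrow> (h \<cdot> g) \<cdot> f = h \<cdot> (g \<cdot> f)"

definition inverse_arrows :: "('o, 'm, 'z) category_scheme \<Rightarrow> 'm \<Rightarrow> 'm \<Rightarrow> bool" where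
  "inverse_arrows C f g \<longleftrightarrow>
     f \<in> Arr C \<and> g \<in> hom C (Cod C f) (Dom C f) \<and>
     g \<cdot>\<^bsub>C\<^esub> f = Ident C (Dom C f) \<and> f \<cdot>\<^bsub>C\<^esub> g = Ident C (Cod C f)"

definition iso :: "('o, 'm, 'z) category_scheme \<Rightarrow> 'm \<Rightarrow> bool" where
  "iso C f \<longleftrightarrow> (\<exists>g. inverse_arrows C f g)"

definition inverse_arr :: "('o, 'm, 'z) category_scheme \<Rightarrow> 'm \<Rightarrow> 'm" where
  "inverse_arr C f = (THE g. inverse_arrows C f g)"


section \<open>Monoidal categories\<close>

record ('o, 'm) monoidal_category = "('o, 'm) category" +
  tensor_ob :: "'o \<Rightarrow> 'o \<Rightarrow> 'o"  (infixr "\<odot>\<index>" 70)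
  tensor :: "'m \<Rightarrow> 'm \<Rightarrow> 'm"  (infixr "\<otimes>\<index>" 70)
  Unit :: 'o
  assoc :: "'o \<Rightarrow> 'o \<Rightarrow> 'o \<Rightarrow> 'm"
  lunit :: "'o \<Rightarrow> 'm"
  runit :: "'o \<Rightarrow> 'm"

text \<open>The tensor product is written \<open>\<odot>\<close> on objects and \<open>\<otimes>\<close> on arrows.  The category is not assumed to
  be symmetric, closed or strict.\<close>

locale monoidal_category = category V
  for V :: "('o, 'm) monoidal_category" (structure) +
  assumes tensor_ob_Ob: "\<lbrakk>a \<in> Ob V; b \<in> Ob V\<rbrakk> \<Longrightarrow> a \<odot> b \<in> Ob V"
    and tensor_hom:
      "\<lbrakk>f \<in> hom V a a'; g \<in> hom V b b'\<rbrakk> \<Longrightarrow> f \<otimes> g \<in> hom V (a \<odot> b) (a' \<odot> b')"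
    and tensor_Ident:
      "\<lbrakk>a \<in> Ob V; b \<in> Ob V\<rbrakk> \<Longrightarrow> Ident V a \<otimes> Ident V b = Ident V (a \<odot> b)"
    and tensor_Comp:
      "\<lbrakk>f \<in> hom V a a'; f' \<in> hom V a' a''; g \<in> hom V b b'; g' \<in> hom V b' b''\<rbrakk>
        \<Longrightarrow> (f' \<cdot> f) \<otimes> (g' \<cdot> g) = (f' \<otimes> g') \<cdot> (f \<otimes> g)"
    and Unit_Ob: "Unit V \<in> Ob V"
    and assoc_hom:
      "\<lbrakk>a \<in> Ob V; b \<in> Ob V; c \<in> Ob V\<rbrakk>
        \<Longrightarrow> assoc V a b c \<in> hom V ((a \<odot> b) \<odot> c) (a \<odot> (b \<odot> c))"
    and assoc_iso: "\<lbrakk>a \<in> Ob V; b \<in> Ob V; c \<in> Ob V\<rbrakk> \<Longrightarrow> iso V (assoc V a b c)"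
    and assoc_natural:
      "\<lbrakk>f \<in> hom V a a'; g \<in> hom V b b'; h \<in> hom V c c'\<rbrakk>
        \<Longrightarrow> assoc V a' b' c' \<cdot> ((f \<otimes> g) \<otimes> h) = (f \<otimes> (g \<otimes> h)) \<cdot> assoc V a b c"
    and lunit_hom: "a \<in> Ob V \<Longrightarrow> lunit V a \<in> hom V (Unit V \<odot> a) a"
    and lunit_iso: "a \<in> Ob V \<Longrightarrow> iso V (lunit V a)"
    and lunit_natural:
      "f \<in> hom V a a' \<Longrightarrow> lunit V a' \<cdot> (Ident V (Unit V) \<otimes> f) = f \<cdot> lunit V a"
    and runit_hom: "a \<in> Ob V \<Longrightarrow> runit V a \<in> hom V (a \<odot> Unit V) a"
    and runit_iso: "a \<in> Ob V \<Longrightarrow> iso V (runit V a)"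
    and runit_natural:
      "f \<in> hom V a a' \<Longrightarrow> runit V a' \<cdot> (f \<otimes> Ident V (Unit V)) = f \<cdot> runit V a"
    and pentagon:
      "\<lbrakk>a \<in> Ob V; b \<in> Ob V; c \<in> Ob V; d \<in> Ob V\<rbrakk>
        \<Longrightarrow> (Ident V a \<otimes> assoc V b c d) \<cdot> assoc V a (b \<odot> c) d \<cdot> (assoc V a b c \<otimes> Ident V d)
            = assoc V a b (c \<odot> d) \<cdot> assoc V (a \<odot> b) c d"
    and triangle:
      "\<lbrakk>a \<in> Ob V; b \<in> Ob V\<rbrakk>
        \<Longrightarrow> (Ident V a \<otimes> lunit V b) \<cdot> assoc V a (Unit V) b = runit V a \<otimes> Ident V b"


section \<open>Enriched categories and functors\<close>

record ('a, 'o, 'm) vcategory =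
  VOb :: "'a set"
  VHom :: "'a \<Rightarrow> 'a \<Rightarrow> 'o"
  VComp :: "'a \<Rightarrow> 'a \<Rightarrow> 'a \<Rightarrow> 'm"
  VId :: "'a \<Rightarrow> 'm"

locale vcategory = monoidal_category V
  for V :: "('o, 'm) monoidal_category" (structure)
    and A :: "('a, 'o, 'm) vcategory" +
  assumes VHom_Ob: "\<lbrakk>a \<in> VOb A; b \<in> VOb A\<rbrakk> \<Longrightarrow> VHom A a b \<in> Ob V"
    and VComp_hom:
      "\<lbrakk>a \<in> VOb A; b \<in> VOb A; c \<in> VOb A\<rbrakk>
        \<Longrightarrow> VComp A a b c \<in> hom V (VHom A b c \<odot> VHom A a b) (VHom A a c)"
    and VId_hom: "a \<in> VOb A \<Longrightarrow> VId A a \<in> hom V (Unit V) (VHom A a a)"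
    and VComp_assoc:
      "\<lbrakk>a \<in> VOb A; b \<in> VOb A; c \<in> VOb A; d \<in> VOb A\<rbrakk>
        \<Longrightarrow> VComp A a b d \<cdot> (VComp A b c d \<otimes> Ident V (VHom A a b))
            = VComp A a c d \<cdot> (Ident V (VHom A c d) \<otimes> VComp A a b c)
                \<cdot> assoc V (VHom A c d) (VHom A b c) (VHom A a b)"
    and VComp_VId_left:
      "\<lbrakk>a \<in> VOb A; b \<in> VOb A\<rbrakk>
        \<Longrightarrow> VComp A a b b \<cdot> (VId A b \<otimes> Ident V (VHom A a b)) = lunit V (VHom A a b)"
    and VComp_VId_right:
      "\<lbrakk>a \<in> VOb A; b \<in> VOb A\<rbrakk>
        \<Longrightarrow> VComp A a a b \<cdot> (Ident V (VHom A a b) \<otimes> VId A a) = runit V (VHom A a b)"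

text \<open>A functor is given by its object function \<open>T\<close> and its effect \<open>Th a b\<close> on the hom object
  from \<open>a\<close> to \<open>b\<close>; values outside the objects of the source are irrelevant.\<close>

definition vfunctor ::
  "('o, 'm) monoidal_category \<Rightarrow> ('a, 'o, 'm) vcategory \<Rightarrow> ('b, 'o, 'm) vcategory
    \<Rightarrow> ('a \<Rightarrow> 'b) \<Rightarrow> ('a \<Rightarrow> 'a \<Rightarrow> 'm) \<Rightarrow> bool" where
  "vfunctor V A B T Th \<longleftrightarrow>
     T \<in> VOb A \<rightarrow> VOb B \<and>
     (\<forall>a\<in>VOb A. \<forall>b\<in>VOb A. Th a b \<in> hom V (VHom A a b) (VHom B (T a) (T b))) \<and>
     (\<forall>a\<in>VOb A. \<forall>b\<in>VOb A. \<forall>c\<in>VOb A.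
        VComp B (T a) (T b) (T c) \<cdot>\<^bsub>V\<^esub> (Th b c \<otimes>\<^bsub>V\<^esub> Th a b) = Th a c \<cdot>\<^bsub>V\<^esub> VComp A a b c) \<and>
     (\<forall>a\<in>VOb A. Th a a \<cdot>\<^bsub>V\<^esub> VId A a = VId B (T a))"


section \<open>Adjunction cores and adjunctions\<close>

text \<open>Throughout, \<open>p x a\<close> is the isomorphism from \<open>VHom A (F x) a\<close> to \<open>VHom X x (U a)\<close>.\<close>

definition adjunction_core ::
  "('o, 'm) monoidal_category \<Rightarrow> ('a, 'o, 'm) vcategory \<Rightarrow> ('x, 'o, 'm) vcategory
    \<Rightarrow> ('a \<Rightarrow> 'x) \<Rightarrow> ('x \<Rightarrow> 'a) \<Rightarrow> ('x \<Rightarrow> 'a \<Rightarrow> 'm) \<Rightarrow> bool" where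
  "adjunction_core V A X U F p \<longleftrightarrow>
     U \<in> VOb A \<rightarrow> VOb X \<and> F \<in> VOb X \<rightarrow> VOb A \<and>
     (\<forall>x\<in>VOb X. \<forall>a\<in>VOb A. p x a \<in> hom V (VHom A (F x) a) (VHom X x (U a)) \<and> iso V (p x a))"

definition adjunction ::
  "('o, 'm) monoidal_category \<Rightarrow> ('a, 'o, 'm) vcategory \<Rightarrow> ('x, 'o, 'm) vcategory
    \<Rightarrow> ('a \<Rightarrow> 'x) \<Rightarrow> ('a \<Rightarrow> 'a \<Rightarrow> 'm) \<Rightarrow> ('x \<Rightarrow> 'a) \<Rightarrow> ('x \<Rightarrow> 'x \<Rightarrow> 'm)
    \<Rightarrow> ('x \<Rightarrow> 'a \<Rightarrow> 'm) \<Rightarrow> bool" where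
  "adjunction V A X U Uh F Fh p \<longleftrightarrow>
     vfunctor V A X U Uh \<and> vfunctor V X A F Fh \<and>
     (\<forall>x\<in>VOb X. \<forall>a\<in>VOb A. p x a \<in> hom V (VHom A (F x) a) (VHom X x (U a)) \<and> iso V (p x a)) \<and>
     (\<forall>a\<in>VOb A. \<forall>b\<in>VOb A. \<forall>x\<in>VOb X.
        VComp X x (U a) (U b) \<cdot>\<^bsub>V\<^esub> (Uh a b \<otimes>\<^bsub>V\<^esub> p x a) = p x b \<cdot>\<^bsub>V\<^esub> VComp A (F x) a b) \<and>
     (\<forall>a\<in>VOb A. \<forall>x\<in>VOb X. \<forall>y\<in>VOb X.
        VComp X x y (U a) \<cdot>\<^bsub>V\<^esub> (p y a \<otimes>\<^bsub>V\<^esub> Ident V (VHom X x y))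
        = p x a \<cdot>\<^bsub>V\<^esub> VComp A (F x) (F y) a \<cdot>\<^bsub>V\<^esub> (Ident V (VHom A (F y) a) \<otimes>\<^bsub>V\<^esub> Fh x y))"

definition core_beta ::
  "('o, 'm) monoidal_category \<Rightarrow> ('a, 'o, 'm) vcategory \<Rightarrow> ('x \<Rightarrow> 'a)
    \<Rightarrow> ('x \<Rightarrow> 'a \<Rightarrow> 'm) \<Rightarrow> 'x \<Rightarrow> 'm" where
  "core_beta V A F p x = p x (F x) \<cdot>\<^bsub>V\<^esub> VId A (F x)"

definition core_alpha ::
  "('o, 'm) monoidal_category \<Rightarrow> ('x, 'o, 'm) vcategory \<Rightarrow> ('a \<Rightarrow> 'x)
    \<Rightarrow> ('x \<Rightarrow> 'a \<Rightarrow> 'm) \<Rightarrow> 'a \<Rightarrow> 'm" where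
  "core_alpha V X U p a = inverse_arr V (p (U a) a) \<cdot>\<^bsub>V\<^esub> VId X (U a)"

definition core_U ::
  "('o, 'm) monoidal_category \<Rightarrow> ('a, 'o, 'm) vcategory \<Rightarrow> ('x, 'o, 'm) vcategory
    \<Rightarrow> ('a \<Rightarrow> 'x) \<Rightarrow> ('x \<Rightarrow> 'a) \<Rightarrow> ('x \<Rightarrow> 'a \<Rightarrow> 'm) \<Rightarrow> 'a \<Rightarrow> 'a \<Rightarrow> 'm" where
  "core_U V A X U F p a b =
     p (U a) b \<cdot>\<^bsub>V\<^esub> VComp A (F (U a)) a b
       \<cdot>\<^bsub>V\<^esub> (Ident V (VHom A a b) \<otimes>\<^bsub>V\<^esub> core_alpha V X U p a)
       \<cdot>\<^bsub>V\<^esub> inverse_arr V (runit V (VHom A a b))"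

definition core_F ::
  "('o, 'm) monoidal_category \<Rightarrow> ('a, 'o, 'm) vcategory \<Rightarrow> ('x, 'o, 'm) vcategory
    \<Rightarrow> ('a \<Rightarrow> 'x) \<Rightarrow> ('x \<Rightarrow> 'a) \<Rightarrow> ('x \<Rightarrow> 'a \<Rightarrow> 'm) \<Rightarrow> 'x \<Rightarrow> 'x \<Rightarrow> 'm" where
  "core_F V A X U F p x y =
     inverse_arr V (p x (F y)) \<cdot>\<^bsub>V\<^esub> VComp X x y (U (F y))
       \<cdot>\<^bsub>V\<^esub> (core_beta V A F p y \<otimes>\<^bsub>V\<^esub> Ident V (VHom X x y))
       \<cdot>\<^bsub>V\<^esub> inverse_arr V (lunit V (VHom X x y))"

end

theory Submission
  imports Defs
begin

text \<open>The structure of an adjunction is determined by naturality, by two arguments of Yoneda type.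
  Call a family \<open>Uh\<close> of arrows \<open>\<A>(A,B) \<rightarrow> \<X>(UA,UB)\<close> \<^emph>\<open>natural in A\<close> if
  \<open>comp (Uh \<otimes> \<pi>) = \<pi> comp\<close>, and a family \<open>Fh\<close> of arrows \<open>\<X>(X,Y) \<rightarrow> \<A>(FX,FY)\<close>
  \<^emph>\<open>natural in X\<close> if \<open>comp (\<pi> \<otimes> 1) = \<pi> comp (1 \<otimes> Fh)\<close>.

  Evaluating the first equation at \<open>\<alpha>\<^sub>A\<close>, where \<open>\<pi> \<alpha>\<^sub>A\<close> is the identity \<open>j\<close>, computes
  \<open>Uh\<close> and leaves the arrow constructed from the core as the only candidate
  (\<open>natural_in_A_unique\<close>); dually, evaluating the second at \<open>j\<close> computes \<open>Fh\<close>
  (\<open>natural_in_X_unique\<close>).  Uniqueness of the adjunction follows.  Functoriality is a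
  consequence of naturality (\<open>natural_in_A_vfunctor\<close>, \<open>natural_in_X_vfunctor\<close>): since \<open>\<pi>\<close>
  is invertible, an arrow into \<open>\<X>(UA,UB)\<close> is determined by what it does to \<open>\<pi>\<close> under
  composition, and \<open>comp\<close> is associative and unital.  So an adjunction with core \<open>(U,F,\<pi>)\<close> is
  just a family natural in \<open>A\<close> together with one natural in \<open>X\<close> (\<open>adjunction_iff_natural\<close>),
  and if these exist they are the constructed ones.  Condition (I) says that the constructed
  \<open>U\<^sub>A\<^sub>B\<close> are natural in \<open>A\<close>, and condition (II) that the constructed \<open>F\<^sub>X\<^sub>Y\<close> are natural in
  \<open>X\<close>.

  It remains to see that either naturality yields the other.  If \<open>Uh\<close> is natural in \<open>A\<close>, then
  \<open>\<pi>\<close> is composition with \<open>\<beta>\<close>: \<open>\<pi> = comp (Uh \<otimes> \<beta>) r\<^sup>-\<^sup>1\<close>.  As \<open>\<pi> F\<^sub>X\<^sub>Y\<close> is composition with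
  \<open>\<beta>\<close> by construction, both sides of naturality in \<open>X\<close> become the composite of three factors,
  \<open>Uh\<close>, \<open>\<beta>\<close> and an arrow of \<open>\<X>(X,Y)\<close>, bracketed in the two possible ways
  (\<open>natural_in_X_core_F\<close>).  The converse is dual, with \<open>\<alpha>\<close> in place of \<open>\<beta>\<close>
  (\<open>natural_in_A_core_U\<close>).\<close>


section \<open>Calculating in a monoidal category\<close>

context category
begin

lemma homI: "\<lbrakk>f \<in> Arr C; Dom C f = a; Cod C f = b\<rbrakk> \<Longrightarrow> f \<in> hom C a b"
  by (simp add: hom_def)

text \<open>The rules are stated with \<open>Dom\<close> and \<open>Cod\<close> rather than with hom sets, since a rule about
  \<open>hom C a b\<close> would leave the simplifier to guess the intermediate objects.\<close>

lemma Dom_Cod_Ob [simp]: "f \<in> Arr C \<Longrightarrow> Dom C f \<in> Ob C" "f \<in> Arr C \<Longrightarrow> Cod C f \<in> Ob C"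
  by (simp_all add: Dom_Ob Cod_Ob)

lemma Ident_simps [simp]:
  assumes "a \<in> Ob C"
  shows "Ident C a \<in> Arr C" "Dom C (Ident C a) = a" "Cod C (Ident C a) = a"
  using Ident_hom[OF assms] by (simp_all add: hom_def)

lemma Comp_simps [simp]:
  assumes "f \<in> Arr C" "g \<in> Arr C" "Cod C f = Dom C g"
  shows "g \<cdot> f \<in> Arr C" "Dom C (g \<cdot> f) = Dom C f" "Cod C (g \<cdot> f) = Cod C g"
  using Comp_hom[of f "Dom C f" "Cod C f" g "Cod C g"] assms by (simp_all add: hom_def)

lemma Comp_Ident_simps [simp]:
  "\<lbrakk>f \<in> Arr C; Dom C f = a\<rbrakk> \<Longrightarrow> f \<cdot> Ident C a = f"
  "\<lbrakk>f \<in> Arr C; Cod C f = a\<rbrakk> \<Longrightarrow> Ident C a \<cdot> f = f"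
  by (simp_all add: Comp_Ident[of f _ "Cod C f"] Ident_Comp[of f "Dom C f"] hom_def)

lemma Comp_assoc_simp [simp]:
  "\<lbrakk>f \<in> Arr C; g \<in> Arr C; h \<in> Arr C; Cod C f = Dom C g; Cod C g = Dom C h\<rbrakk>
    \<Longrightarrow> (h \<cdot> g) \<cdot> f = h \<cdot> (g \<cdot> f)"
  by (rule Comp_assoc[of f "Dom C f" "Cod C f" g "Cod C g" h "Cod C h"]) (simp_all add: hom_def)

lemma inverse_arrows_unique:
  assumes "inverse_arrows C f g" "inverse_arrows C f h"
  shows "g = h"
proof -
  have "g = g \<cdot> (f \<cdot> h)" using assms by (simp add: inverse_arrows_def hom_def)
  also have "\<dots> = (g \<cdot> f) \<cdot> h"
    by (subst Comp_assoc_simp) (use assms in \<open>simp_all add: inverse_arrows_def hom_def\<close>)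
  also have "\<dots> = h" using assms by (simp add: inverse_arrows_def hom_def)
  finally show ?thesis .
qed

lemma inverse_arrows_inverse_arr: "iso C f \<Longrightarrow> inverse_arrows C f (inverse_arr C f)"
  unfolding iso_def inverse_arr_def by (metis theI inverse_arrows_unique)

lemma iso_Arr: "iso C f \<Longrightarrow> f \<in> Arr C"
  by (auto simp: iso_def inverse_arrows_def)

lemma inverse_arr_simps [simp]:
  assumes "iso C f"
  shows "inverse_arr C f \<in> Arr C" "Dom C (inverse_arr C f) = Cod C f"
    "Cod C (inverse_arr C f) = Dom C f"
    "inverse_arr C f \<cdot> f = Ident C (Dom C f)" "f \<cdot> inverse_arr C f = Ident C (Cod C f)"
  using inverse_arrows_inverse_arr[OF assms] by (simp_all add: inverse_arrows_def hom_def)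

lemma inverse_arr_Comp_simps [simp]:
  assumes "iso C f" "h \<in> Arr C"
  shows "Cod C h = Dom C f \<Longrightarrow> inverse_arr C f \<cdot> (f \<cdot> h) = h"
    and "Cod C h = Cod C f \<Longrightarrow> f \<cdot> (inverse_arr C f \<cdot> h) = h"
  using assms iso_Arr[OF assms(1)] by (simp_all flip: Comp_assoc_simp)

lemma iso_cancel_left:
  assumes "iso C q" "f \<in> Arr C" "g \<in> Arr C" "Cod C f = Dom C q" "Cod C g = Dom C q"
    and "q \<cdot> f = q \<cdot> g"
  shows "f = g"
  using assms inverse_arr_Comp_simps(1) by metis

lemma iso_cancel_right:
  assumes "iso C q" "f \<in> Arr C" "g \<in> Arr C" "Dom C f = Cod C q" "Dom C g = Cod C q"
    and "f \<cdot> q = g \<cdot> q"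
  shows "f = g"
proof -
  have "(f \<cdot> q) \<cdot> inverse_arr C q = (g \<cdot> q) \<cdot> inverse_arr C q" using assms(6) by simp
  then show ?thesis using assms(1-5) iso_Arr[OF assms(1)] by simp
qed

end

context monoidal_category
begin

lemma tensor_simps [simp]:
  "\<lbrakk>a \<in> Ob V; b \<in> Ob V\<rbrakk> \<Longrightarrow> a \<odot> b \<in> Ob V"
  "\<lbrakk>f \<in> Arr V; g \<in> Arr V\<rbrakk> \<Longrightarrow> f \<otimes> g \<in> Arr V"
  "\<lbrakk>f \<in> Arr V; g \<in> Arr V\<rbrakk> \<Longrightarrow> Dom V (f \<otimes> g) = Dom V f \<odot> Dom V g"
  "\<lbrakk>f \<in> Arr V; g \<in> Arr V\<rbrakk> \<Longrightarrow> Cod V (f \<otimes> g) = Cod V f \<odot> Cod V g"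
  "\<lbrakk>a \<in> Ob V; b \<in> Ob V\<rbrakk> \<Longrightarrow> Ident V a \<otimes> Ident V b = Ident V (a \<odot> b)"
  using tensor_hom[of f "Dom V f" "Cod V f" g "Dom V g" "Cod V g"]
  by (simp_all add: hom_def tensor_ob_Ob tensor_Ident)

text \<open>Oriented this way, the interchange law merges adjacent tensors.  Together with right-bracketed
  composition and the unit laws it gives a normal form, so that structural steps below are settled by
  simplification alone.\<close>

lemma interchange [simp]:
  "\<lbrakk>f \<in> Arr V; f' \<in> Arr V; g \<in> Arr V; g' \<in> Arr V; Cod V f = Dom V f'; Cod V g = Dom V g'\<rbrakk>
    \<Longrightarrow> (f' \<otimes> g') \<cdot> (f \<otimes> g) = (f' \<cdot> f) \<otimes> (g' \<cdot> g)"
  by (rule tensor_Comp[symmetric]) (rule homI; simp)+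

lemma interchange_Comp [simp]:
  assumes "f \<in> Arr V" "f' \<in> Arr V" "g \<in> Arr V" "g' \<in> Arr V"
    and "Cod V f = Dom V f'" "Cod V g = Dom V g'"
    and "k \<in> Arr V" "Cod V k = Dom V f \<odot> Dom V g"
  shows "(f' \<otimes> g') \<cdot> ((f \<otimes> g) \<cdot> k) = ((f' \<cdot> f) \<otimes> (g' \<cdot> g)) \<cdot> k"
  using assms by (simp flip: interchange)

lemma iso_tensor [simp]:
  assumes "iso V f" "iso V g"
  shows "iso V (f \<otimes> g)"
proof -
  have "inverse_arrows V (f \<otimes> g) (inverse_arr V f \<otimes> inverse_arr V g)"
    using assms iso_Arr[OF assms(1)] iso_Arr[OF assms(2)]
    by (simp add: inverse_arrows_def hom_def)
  then show ?thesis by (auto simp: iso_def)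
qed

lemma iso_Ident [simp]: "a \<in> Ob V \<Longrightarrow> iso V (Ident V a)"
  by (auto simp: iso_def inverse_arrows_def hom_def intro!: exI[of _ "Ident V a"])

lemma Unit_simp [simp]: "Unit V \<in> Ob V"
  by (rule Unit_Ob)

lemma structure_simps [simp]:
  "a \<in> Ob V \<Longrightarrow> iso V (lunit V a)"
  "a \<in> Ob V \<Longrightarrow> lunit V a \<in> Arr V"
  "a \<in> Ob V \<Longrightarrow> Dom V (lunit V a) = Unit V \<odot> a"
  "a \<in> Ob V \<Longrightarrow> Cod V (lunit V a) = a"
  "a \<in> Ob V \<Longrightarrow> iso V (runit V a)"
  "a \<in> Ob V \<Longrightarrow> runit V a \<in> Arr V"
  "a \<in> Ob V \<Longrightarrow> Dom V (runit V a) = a \<odot> Unit V"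
  "a \<in> Ob V \<Longrightarrow> Cod V (runit V a) = a"
  "\<lbrakk>a \<in> Ob V; b \<in> Ob V; c \<in> Ob V\<rbrakk> \<Longrightarrow> iso V (assoc V a b c)"
  "\<lbrakk>a \<in> Ob V; b \<in> Ob V; c \<in> Ob V\<rbrakk> \<Longrightarrow> assoc V a b c \<in> Arr V"
  "\<lbrakk>a \<in> Ob V; b \<in> Ob V; c \<in> Ob V\<rbrakk> \<Longrightarrow> Dom V (assoc V a b c) = (a \<odot> b) \<odot> c"
  "\<lbrakk>a \<in> Ob V; b \<in> Ob V; c \<in> Ob V\<rbrakk> \<Longrightarrow> Cod V (assoc V a b c) = a \<odot> (b \<odot> c)"
  using lunit_hom[of a] runit_hom[of a] assoc_hom[of a b c] lunit_iso runit_iso assoc_iso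
  by (simp_all add: hom_def)

lemma lunit_natural_Arr:
  "f \<in> Arr V \<Longrightarrow> lunit V (Cod V f) \<cdot> (Ident V (Unit V) \<otimes> f) = f \<cdot> lunit V (Dom V f)"
  by (rule lunit_natural) (simp add: hom_def)

lemma runit_natural_Arr:
  "f \<in> Arr V \<Longrightarrow> runit V (Cod V f) \<cdot> (f \<otimes> Ident V (Unit V)) = f \<cdot> runit V (Dom V f)"
  by (rule runit_natural) (simp add: hom_def)

lemma assoc_natural_Arr:
  "\<lbrakk>f \<in> Arr V; g \<in> Arr V; h \<in> Arr V\<rbrakk>
    \<Longrightarrow> assoc V (Cod V f) (Cod V g) (Cod V h) \<cdot> ((f \<otimes> g) \<otimes> h)
        = (f \<otimes> (g \<otimes> h)) \<cdot> assoc V (Dom V f) (Dom V g) (Dom V h)"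
  by (rule assoc_natural) (simp_all add: hom_def)

text \<open>The two ways of inserting a unit between \<open>a\<close> and \<open>b\<close> agree.  This is the only form in which
  the coherence axioms on units are needed below.\<close>

lemma triangle_inverse:
  assumes "a \<in> Ob V" "b \<in> Ob V"
  shows "assoc V a (Unit V) b \<cdot> (inverse_arr V (runit V a) \<otimes> Ident V b)
    = Ident V a \<otimes> inverse_arr V (lunit V b)"
proof (rule iso_cancel_left[of "Ident V a \<otimes> lunit V b"])
  have "(Ident V a \<otimes> lunit V b) \<cdot> assoc V a (Unit V) b \<cdot> (inverse_arr V (runit V a) \<otimes> Ident V b)
      = ((Ident V a \<otimes> lunit V b) \<cdot> assoc V a (Unit V) b) \<cdot> (inverse_arr V (runit V a) \<otimes> Ident V b)"
    using assms by simp
  also have "\<dots> = Ident V (a \<odot> b)" using assms by (simp add: triangle)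
  finally show "(Ident V a \<otimes> lunit V b) \<cdot> assoc V a (Unit V) b
        \<cdot> (inverse_arr V (runit V a) \<otimes> Ident V b)
      = (Ident V a \<otimes> lunit V b) \<cdot> (Ident V a \<otimes> inverse_arr V (lunit V b))"
    using assms by simp
qed (use assms in simp_all)

end


section \<open>Cancellation in an enriched category\<close>

context vcategory
begin

lemma VCat_simps [simp]:
  "\<lbrakk>a \<in> VOb A; b \<in> VOb A\<rbrakk> \<Longrightarrow> VHom A a b \<in> Ob V"
  "\<lbrakk>a \<in> VOb A; b \<in> VOb A; c \<in> VOb A\<rbrakk> \<Longrightarrow> VComp A a b c \<in> Arr V"
  "\<lbrakk>a \<in> VOb A; b \<in> VOb A; c \<in> VOb A\<rbrakk> \<Longrightarrow> Dom V (VComp A a b c) = VHom A b c \<odot> VHom A a b"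
  "\<lbrakk>a \<in> VOb A; b \<in> VOb A; c \<in> VOb A\<rbrakk> \<Longrightarrow> Cod V (VComp A a b c) = VHom A a c"
  "a \<in> VOb A \<Longrightarrow> VId A a \<in> Arr V"
  "a \<in> VOb A \<Longrightarrow> Dom V (VId A a) = Unit V"
  "a \<in> VOb A \<Longrightarrow> Cod V (VId A a) = VHom A a a"
  using VHom_Ob VComp_hom[of a b c] VId_hom[of a] by (simp_all add: hom_def)

text \<open>Objects of \<open>\<V>\<close> have no elements, so calculations in an enriched category run on generalized elements,
  that is, arrows into hom objects.  This is the unit axiom evaluated at such an element.\<close>

lemma VComp_VId_right_Arr:
  assumes "a \<in> VOb A" "b \<in> VOb A" "f \<in> Arr V" "Cod V f = VHom A a b"
  shows "VComp A a a b \<cdot> (f \<otimes> VId A a) = f \<cdot> runit V (Dom V f)"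
proof -
  have "VComp A a a b \<cdot> (f \<otimes> VId A a)
      = (VComp A a a b \<cdot> (Ident V (VHom A a b) \<otimes> VId A a)) \<cdot> (f \<otimes> Ident V (Unit V))"
    using assms by simp
  also have "\<dots> = runit V (Cod V f) \<cdot> (f \<otimes> Ident V (Unit V))"
    using assms by (simp add: VComp_VId_right)
  also have "\<dots> = f \<cdot> runit V (Dom V f)" using assms(3) by (rule runit_natural_Arr)
  finally show ?thesis .
qed

lemma VComp_VId_left_Arr:
  assumes "a \<in> VOb A" "b \<in> VOb A" "f \<in> Arr V" "Cod V f = VHom A a b"
  shows "VComp A a b b \<cdot> (VId A b \<otimes> f) = f \<cdot> lunit V (Dom V f)"
proof -
  have "VComp A a b b \<cdot> (VId A b \<otimes> f)
      = (VComp A a b b \<cdot> (VId A b \<otimes> Ident V (VHom A a b))) \<cdot> (Ident V (Unit V) \<otimes> f)"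
    using assms by simp
  also have "\<dots> = lunit V (Cod V f) \<cdot> (Ident V (Unit V) \<otimes> f)"
    using assms by (simp add: VComp_VId_left)
  also have "\<dots> = f \<cdot> lunit V (Dom V f)" using assms(3) by (rule lunit_natural_Arr)
  finally show ?thesis .
qed

text \<open>Precomposing the second factor with \<open>q\<^sup>-\<^sup>1 j\<close> turns composition with \<open>q\<close> into composition with the
  identity, which recovers \<open>f\<close> from \<open>comp (f \<otimes> q)\<close> up to the invertible unit constraint.\<close>

lemma VComp_cancel_right:
  assumes ob: "a \<in> VOb A" "b \<in> VOb A"
    and f: "f \<in> Arr V" "Cod V f = VHom A a b"
    and g: "g \<in> Arr V" "Cod V g = VHom A a b" "Dom V g = Dom V f"
    and q: "iso V q" "Cod V q = VHom A a a"
    and eq: "VComp A a a b \<cdot> (f \<otimes> q) = VComp A a a b \<cdot> (g \<otimes> q)"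
  shows "f = g"
proof -
  note [simp] = iso_Arr[OF q(1)]
  have expand: "h \<cdot> runit V (Dom V h)
      = (VComp A a a b \<cdot> (h \<otimes> q)) \<cdot> (Ident V (Dom V h) \<otimes> (inverse_arr V q \<cdot> VId A a))"
    if "h \<in> Arr V" "Cod V h = VHom A a b" for h
    using that ob q by (simp add: VComp_VId_right_Arr)
  have "f \<cdot> runit V (Dom V f) = g \<cdot> runit V (Dom V f)"
    using expand[OF f] expand[OF g(1,2)] eq g(3) by simp
  then show ?thesis
    by (rule iso_cancel_right[rotated 5]) (use f g in simp_all)
qed

text \<open>The mirror image, in the simpler case where the other factor is the identity of \<open>\<A>(B,B)\<close>.\<close>

lemma VComp_cancel_left:
  assumes ob: "a \<in> VOb A" "b \<in> VOb A"
    and f: "f \<in> Arr V" "Cod V f = VHom A a b"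
    and g: "g \<in> Arr V" "Cod V g = VHom A a b" "Dom V g = Dom V f"
    and eq: "VComp A a b b \<cdot> (Ident V (VHom A b b) \<otimes> f)
      = VComp A a b b \<cdot> (Ident V (VHom A b b) \<otimes> g)"
  shows "f = g"
proof -
  have expand: "h \<cdot> lunit V (Dom V h)
      = (VComp A a b b \<cdot> (Ident V (VHom A b b) \<otimes> h)) \<cdot> (VId A b \<otimes> Ident V (Dom V h))"
    if "h \<in> Arr V" "Cod V h = VHom A a b" for h
    using that ob by (simp add: VComp_VId_left_Arr)
  have "f \<cdot> lunit V (Dom V f) = g \<cdot> lunit V (Dom V f)"
    using expand[OF f] expand[OF g(1,2)] eq g(3) by simp
  then show ?thesis
    by (rule iso_cancel_right[rotated 5]) (use f g in simp_all)
qed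

lemma VComp_assoc_Arr:
  assumes ob: "a \<in> VOb A" "b \<in> VOb A" "c \<in> VOb A" "d \<in> VOb A"
    and f: "f \<in> Arr V" "Cod V f = VHom A a b"
    and g: "g \<in> Arr V" "Cod V g = VHom A b c"
    and h: "h \<in> Arr V" "Cod V h = VHom A c d"
  shows "VComp A a b d \<cdot> ((VComp A b c d \<cdot> (h \<otimes> g)) \<otimes> f)
    = VComp A a c d \<cdot> (h \<otimes> (VComp A a b c \<cdot> (g \<otimes> f)))
        \<cdot> assoc V (Dom V h) (Dom V g) (Dom V f)"
proof -
  have "VComp A a b d \<cdot> ((VComp A b c d \<cdot> (h \<otimes> g)) \<otimes> f)
      = (VComp A a b d \<cdot> (VComp A b c d \<otimes> Ident V (VHom A a b))) \<cdot> ((h \<otimes> g) \<otimes> f)"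
    using assms by simp
  also have "\<dots> = VComp A a c d \<cdot> (Ident V (VHom A c d) \<otimes> VComp A a b c)
      \<cdot> (assoc V (Cod V h) (Cod V g) (Cod V f) \<cdot> ((h \<otimes> g) \<otimes> f))"
    using assms by (simp add: VComp_assoc)
  also have "\<dots> = VComp A a c d \<cdot> (Ident V (VHom A c d) \<otimes> VComp A a b c)
      \<cdot> ((h \<otimes> (g \<otimes> f)) \<cdot> assoc V (Dom V h) (Dom V g) (Dom V f))"
    using f(1) g(1) h(1) by (simp only: assoc_natural_Arr)
  also have "\<dots> = VComp A a c d \<cdot> (h \<otimes> (VComp A a b c \<cdot> (g \<otimes> f)))
        \<cdot> assoc V (Dom V h) (Dom V g) (Dom V f)"
    using assms by simp
  finally show ?thesis .
qed

text \<open>Associativity of a threefold composite whose middle factor \<open>g\<close> is a global element \<open>I \<rightarrow> \<A>(B,C)\<close>.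
  The units are absorbed into \<open>h\<close> on one side and into \<open>f\<close> on the other, so by the triangle axiom
  the associator disappears.\<close>

lemma VComp_assoc_Unit:
  assumes ob: "a \<in> VOb A" "b \<in> VOb A" "c \<in> VOb A" "d \<in> VOb A"
    and f: "f \<in> Arr V" "Cod V f = VHom A a b"
    and g: "g \<in> Arr V" "Cod V g = VHom A b c" "Dom V g = Unit V"
    and h: "h \<in> Arr V" "Cod V h = VHom A c d"
  shows "VComp A a b d \<cdot> ((VComp A b c d \<cdot> (h \<otimes> g) \<cdot> inverse_arr V (runit V (Dom V h))) \<otimes> f)
    = VComp A a c d \<cdot> (h \<otimes> (VComp A a b c \<cdot> (g \<otimes> f) \<cdot> inverse_arr V (lunit V (Dom V f))))"
proof -
  let ?r = "inverse_arr V (runit V (Dom V h)) \<otimes> Ident V (Dom V f)"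
  have "VComp A a b d \<cdot> ((VComp A b c d \<cdot> (h \<otimes> g) \<cdot> inverse_arr V (runit V (Dom V h))) \<otimes> f)
      = (VComp A a b d \<cdot> ((VComp A b c d \<cdot> (h \<otimes> g)) \<otimes> f)) \<cdot> ?r"
    using assms by simp
  also have "\<dots> = (VComp A a c d \<cdot> (h \<otimes> (VComp A a b c \<cdot> (g \<otimes> f)))
        \<cdot> assoc V (Dom V h) (Unit V) (Dom V f)) \<cdot> ?r"
    using assms by (simp only: VComp_assoc_Arr)
  also have "\<dots> = VComp A a c d \<cdot> (h \<otimes> (VComp A a b c \<cdot> (g \<otimes> f)))
        \<cdot> (assoc V (Dom V h) (Unit V) (Dom V f) \<cdot> ?r)"
    using assms by simp
  also have "\<dots> = VComp A a c d \<cdot> (h \<otimes> (VComp A a b c \<cdot> (g \<otimes> f)))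
        \<cdot> (Ident V (Dom V h) \<otimes> inverse_arr V (lunit V (Dom V f)))"
    using assms by (simp only: triangle_inverse Dom_Cod_Ob)
  also have "\<dots> = VComp A a c d
      \<cdot> (h \<otimes> (VComp A a b c \<cdot> (g \<otimes> f) \<cdot> inverse_arr V (lunit V (Dom V f))))"
    using assms by simp
  finally show ?thesis .
qed

end


section \<open>Naturality of a core in one variable\<close>

locale core_of_adjunction =
  monoidal_category V + A: vcategory V A + X: vcategory V X
  for V :: "('o, 'm) monoidal_category" (structure)
    and A :: "('a, 'o, 'm) vcategory" and X :: "('x, 'o, 'm) vcategory" +
  fixes U :: "'a \<Rightarrow> 'x" and F :: "'x \<Rightarrow> 'a" and p :: "'x \<Rightarrow> 'a \<Rightarrow> 'm"
  assumes core: "adjunction_core V A X U F p"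
begin

text \<open>The two naturality conditions for an adjunction, each including the types of the arrows but not
  functoriality.\<close>

definition natural_in_A :: "('a \<Rightarrow> 'a \<Rightarrow> 'm) \<Rightarrow> bool" where
  "natural_in_A Uh \<longleftrightarrow>
     (\<forall>a\<in>VOb A. \<forall>b\<in>VOb A. Uh a b \<in> hom V (VHom A a b) (VHom X (U a) (U b))) \<and>
     (\<forall>a\<in>VOb A. \<forall>b\<in>VOb A. \<forall>x\<in>VOb X.
        VComp X x (U a) (U b) \<cdot> (Uh a b \<otimes> p x a) = p x b \<cdot> VComp A (F x) a b)"

definition natural_in_X :: "('x \<Rightarrow> 'x \<Rightarrow> 'm) \<Rightarrow> bool" where
  "natural_in_X Fh \<longleftrightarrow>
     (\<forall>x\<in>VOb X. \<forall>y\<in>VOb X. Fh x y \<in> hom V (VHom X x y) (VHom A (F x) (F y))) \<and>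
     (\<forall>a\<in>VOb A. \<forall>x\<in>VOb X. \<forall>y\<in>VOb X.
        VComp X x y (U a) \<cdot> (p y a \<otimes> Ident V (VHom X x y))
        = p x a \<cdot> VComp A (F x) (F y) a \<cdot> (Ident V (VHom A (F y) a) \<otimes> Fh x y))"

abbreviation "\<alpha> \<equiv> core_alpha V X U p"
abbreviation "\<beta> \<equiv> core_beta V A F p"
abbreviation "U\<^sub>c \<equiv> core_U V A X U F p"
abbreviation "F\<^sub>c \<equiv> core_F V A X U F p"

lemma core_simps [simp]:
  "a \<in> VOb A \<Longrightarrow> U a \<in> VOb X"
  "x \<in> VOb X \<Longrightarrow> F x \<in> VOb A"
  "\<lbrakk>x \<in> VOb X; a \<in> VOb A\<rbrakk> \<Longrightarrow> iso V (p x a)"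
  "\<lbrakk>x \<in> VOb X; a \<in> VOb A\<rbrakk> \<Longrightarrow> p x a \<in> Arr V"
  "\<lbrakk>x \<in> VOb X; a \<in> VOb A\<rbrakk> \<Longrightarrow> Dom V (p x a) = VHom A (F x) a"
  "\<lbrakk>x \<in> VOb X; a \<in> VOb A\<rbrakk> \<Longrightarrow> Cod V (p x a) = VHom X x (U a)"
  using core by (auto simp: adjunction_core_def hom_def)

lemma alpha_beta_simps [simp]:
  "a \<in> VOb A \<Longrightarrow> \<alpha> a \<in> Arr V"
  "a \<in> VOb A \<Longrightarrow> Dom V (\<alpha> a) = Unit V"
  "a \<in> VOb A \<Longrightarrow> Cod V (\<alpha> a) = VHom A (F (U a)) a"
  "x \<in> VOb X \<Longrightarrow> \<beta> x \<in> Arr V"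
  "x \<in> VOb X \<Longrightarrow> Dom V (\<beta> x) = Unit V"
  "x \<in> VOb X \<Longrightarrow> Cod V (\<beta> x) = VHom X x (U (F x))"
  by (simp_all add: core_alpha_def core_beta_def)

lemma core_U_simps [simp]:
  assumes "a \<in> VOb A" "b \<in> VOb A"
  shows "U\<^sub>c a b \<in> Arr V" "Dom V (U\<^sub>c a b) = VHom A a b" "Cod V (U\<^sub>c a b) = VHom X (U a) (U b)"
  using assms by (simp_all add: core_U_def)

lemma core_F_simps [simp]:
  assumes "x \<in> VOb X" "y \<in> VOb X"
  shows "F\<^sub>c x y \<in> Arr V" "Dom V (F\<^sub>c x y) = VHom X x y" "Cod V (F\<^sub>c x y) = VHom A (F x) (F y)"
  using assms by (simp_all add: core_F_def)

lemma natural_in_A_simps: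
  assumes "natural_in_A Uh" "a \<in> VOb A" "b \<in> VOb A"
  shows "Uh a b \<in> Arr V" "Dom V (Uh a b) = VHom A a b" "Cod V (Uh a b) = VHom X (U a) (U b)"
  using assms by (auto simp: natural_in_A_def hom_def)

lemma natural_in_X_simps:
  assumes "natural_in_X Fh" "x \<in> VOb X" "y \<in> VOb X"
  shows "Fh x y \<in> Arr V" "Dom V (Fh x y) = VHom X x y" "Cod V (Fh x y) = VHom A (F x) (F y)"
  using assms by (auto simp: natural_in_X_def hom_def)

text \<open>Naturality evaluated at generalized elements: \<open>\<pi> (f \<circ> g) = Uh f \<circ> \<pi> g\<close>, which is how the
  calculations below use it.\<close>

lemma natural_in_A_Comp:
  assumes nat: "natural_in_A Uh" and ob: "a \<in> VOb A" "b \<in> VOb A" "x \<in> VOb X"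
    and fg: "f \<in> Arr V" "Cod V f = VHom A a b" "g \<in> Arr V" "Cod V g = VHom A (F x) a"
  shows "p x b \<cdot> VComp A (F x) a b \<cdot> (f \<otimes> g)
    = VComp X x (U a) (U b) \<cdot> ((Uh a b \<cdot> f) \<otimes> (p x a \<cdot> g))"
proof -
  note [simp] = natural_in_A_simps[OF nat]
  have "p x b \<cdot> VComp A (F x) a b \<cdot> (f \<otimes> g) = (p x b \<cdot> VComp A (F x) a b) \<cdot> (f \<otimes> g)"
    using ob fg by simp
  also have "\<dots> = (VComp X x (U a) (U b) \<cdot> (Uh a b \<otimes> p x a)) \<cdot> (f \<otimes> g)"
    using nat ob by (simp only: natural_in_A_def)
  also have "\<dots> = VComp X x (U a) (U b) \<cdot> ((Uh a b \<cdot> f) \<otimes> (p x a \<cdot> g))"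
    using ob fg by simp
  finally show ?thesis .
qed

text \<open>Likewise \<open>\<pi> (f \<circ> Fh g) = \<pi> f \<circ> g\<close>.\<close>

lemma natural_in_X_Comp:
  assumes nat: "natural_in_X Fh" and ob: "a \<in> VOb A" "x \<in> VOb X" "y \<in> VOb X"
    and fg: "f \<in> Arr V" "Cod V f = VHom A (F y) a" "g \<in> Arr V" "Cod V g = VHom X x y"
  shows "p x a \<cdot> VComp A (F x) (F y) a \<cdot> (f \<otimes> (Fh x y \<cdot> g))
    = VComp X x y (U a) \<cdot> ((p y a \<cdot> f) \<otimes> g)"
proof -
  note [simp] = natural_in_X_simps[OF nat]
  have "p x a \<cdot> VComp A (F x) (F y) a \<cdot> (f \<otimes> (Fh x y \<cdot> g))
      = (p x a \<cdot> VComp A (F x) (F y) a \<cdot> (Ident V (VHom A (F y) a) \<otimes> Fh x y)) \<cdot> (f \<otimes> g)"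
    using ob fg by simp
  also have "\<dots> = (VComp X x y (U a) \<cdot> (p y a \<otimes> Ident V (VHom X x y))) \<cdot> (f \<otimes> g)"
    using nat ob by (simp only: natural_in_X_def)
  also have "\<dots> = VComp X x y (U a) \<cdot> ((p y a \<cdot> f) \<otimes> g)"
    using ob fg by simp
  finally show ?thesis .
qed

text \<open>By naturality \<open>\<pi> comp (1 \<otimes> \<alpha>) = comp (Uh \<otimes> \<pi> \<alpha>)\<close>, and \<open>\<pi> \<alpha>\<close> is an identity of \<open>\<X>\<close>, so the
  constructed arrow is \<open>Uh\<close> followed by composition with an identity.\<close>

lemma natural_in_A_unique:
  assumes nat: "natural_in_A Uh" and ob: "a \<in> VOb A" "b \<in> VOb A"
  shows "Uh a b = U\<^sub>c a b"
proof -
  note [simp] = natural_in_A_simps[OF nat]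
  have "U\<^sub>c a b = (p (U a) b \<cdot> VComp A (F (U a)) a b \<cdot> (Ident V (VHom A a b) \<otimes> \<alpha> a))
      \<cdot> inverse_arr V (runit V (VHom A a b))"
    using ob by (simp add: core_U_def)
  also have "\<dots> = (VComp X (U a) (U a) (U b) \<cdot> (Uh a b \<otimes> VId X (U a)))
      \<cdot> inverse_arr V (runit V (VHom A a b))"
    using ob by (simp add: natural_in_A_Comp[OF nat]) (simp add: core_alpha_def)
  also have "\<dots> = Uh a b"
    using ob by (simp add: X.VComp_VId_right_Arr)
  finally show ?thesis by simp
qed

text \<open>Dual: \<open>\<beta>\<close> is \<open>\<pi> j\<close>, and naturality moves \<open>\<pi>\<close> out of \<open>comp (\<pi> j \<otimes> 1)\<close>, where it cancels against
  the inverse in the construction.\<close>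

lemma natural_in_X_unique:
  assumes nat: "natural_in_X Fh" and ob: "x \<in> VOb X" "y \<in> VOb X"
  shows "Fh x y = F\<^sub>c x y"
proof -
  note [simp] = natural_in_X_simps[OF nat]
  have "F\<^sub>c x y = inverse_arr V (p x (F y))
      \<cdot> (VComp X x y (U (F y)) \<cdot> ((p y (F y) \<cdot> VId A (F y)) \<otimes> Ident V (VHom X x y)))
      \<cdot> inverse_arr V (lunit V (VHom X x y))"
    using ob by (simp add: core_F_def core_beta_def)
  also have "\<dots> = inverse_arr V (p x (F y))
      \<cdot> (p x (F y) \<cdot> VComp A (F x) (F y) (F y)
          \<cdot> (VId A (F y) \<otimes> (Fh x y \<cdot> Ident V (VHom X x y))))
      \<cdot> inverse_arr V (lunit V (VHom X x y))"
    by (subst natural_in_X_Comp[OF nat, of "F y" x y]) (use ob in simp_all)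
  also have "\<dots> = (VComp A (F x) (F y) (F y) \<cdot> (VId A (F y) \<otimes> Fh x y))
      \<cdot> inverse_arr V (lunit V (VHom X x y))"
    using ob by simp
  also have "\<dots> = Fh x y"
    using ob by (simp add: A.VComp_VId_left_Arr)
  finally show ?thesis by simp
qed

text \<open>Both functor equations have sides in \<open>\<X>(UA,UB)\<close>, so they may be tested by composing with
  \<open>\<pi>\<^bsub>UA,A\<^esub>\<close>.  There naturality transports them to the unit and associativity laws of \<open>\<A>\<close>.
  Testing the unit equation this way also avoids any comparison of \<open>l\<^sub>I\<close> with \<open>r\<^sub>I\<close>.\<close>

lemma natural_in_A_vfunctor:
  assumes nat: "natural_in_A Uh"
  shows "vfunctor V A X U Uh"
proof -
  note [simp] = natural_in_A_simps[OF nat]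
  have "Uh a a \<cdot> VId A a = VId X (U a)" if ob: "a \<in> VOb A" for a
  proof (rule X.VComp_cancel_right[of "U a" "U a" _ _ "p (U a) a"])
    have "VComp X (U a) (U a) (U a) \<cdot> ((Uh a a \<cdot> VId A a) \<otimes> p (U a) a)
        = p (U a) a \<cdot> VComp A (F (U a)) a a \<cdot> (VId A a \<otimes> Ident V (VHom A (F (U a)) a))"
      using ob by (simp add: natural_in_A_Comp[OF nat])
    also have "\<dots> = VComp X (U a) (U a) (U a) \<cdot> (VId X (U a) \<otimes> p (U a) a)"
      using ob by (simp add: A.VComp_VId_left_Arr X.VComp_VId_left_Arr)
    finally show "VComp X (U a) (U a) (U a) \<cdot> ((Uh a a \<cdot> VId A a) \<otimes> p (U a) a)
      = VComp X (U a) (U a) (U a) \<cdot> (VId X (U a) \<otimes> p (U a) a)" .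
  qed (use ob in simp_all)
  moreover have "VComp X (U a) (U b) (U c) \<cdot> (Uh b c \<otimes> Uh a b) = Uh a c \<cdot> VComp A a b c"
    if ob: "a \<in> VOb A" "b \<in> VOb A" "c \<in> VOb A" for a b c
  proof (rule X.VComp_cancel_right[of "U a" "U c" _ _ "p (U a) a"])
    let ?x = "U a"
    let ?assoc = "assoc V (VHom A b c) (VHom A a b) (VHom A (F ?x) a)"
    have "VComp X ?x (U a) (U c) \<cdot> ((VComp X (U a) (U b) (U c) \<cdot> (Uh b c \<otimes> Uh a b)) \<otimes> p ?x a)
      = VComp X ?x (U b) (U c) \<cdot> (Uh b c \<otimes> (VComp X ?x (U a) (U b) \<cdot> (Uh a b \<otimes> p ?x a))) \<cdot> ?assoc"
      using ob by (simp add: X.VComp_assoc_Arr)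
    also have "\<dots> = VComp X ?x (U b) (U c) \<cdot> (Uh b c \<otimes> (p ?x b \<cdot> VComp A (F ?x) a b)) \<cdot> ?assoc"
      using nat ob by (simp add: natural_in_A_def)
    also have "\<dots> = (VComp X ?x (U b) (U c)
        \<cdot> ((Uh b c \<cdot> Ident V (VHom A b c)) \<otimes> (p ?x b \<cdot> VComp A (F ?x) a b))) \<cdot> ?assoc"
      using ob by simp
    also have "\<dots> = (p ?x c \<cdot> VComp A (F ?x) b c
        \<cdot> (Ident V (VHom A b c) \<otimes> VComp A (F ?x) a b)) \<cdot> ?assoc"
      using ob by (subst natural_in_A_Comp[OF nat]) simp_all
    also have "\<dots> = p ?x c \<cdot> (VComp A (F ?x) b c
        \<cdot> (Ident V (VHom A b c) \<otimes> VComp A (F ?x) a b) \<cdot> ?assoc)"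
      using ob by simp
    also have "\<dots> = p ?x c \<cdot> VComp A (F ?x) a c
        \<cdot> (VComp A a b c \<otimes> Ident V (VHom A (F ?x) a))"
      using ob by (subst A.VComp_assoc) simp_all
    also have "\<dots> = VComp X ?x (U a) (U c) \<cdot> ((Uh a c \<cdot> VComp A a b c) \<otimes> p ?x a)"
      using ob by (simp add: natural_in_A_Comp[OF nat])
    finally show "VComp X ?x (U a) (U c)
        \<cdot> ((VComp X (U a) (U b) (U c) \<cdot> (Uh b c \<otimes> Uh a b)) \<otimes> p ?x a)
      = VComp X ?x (U a) (U c) \<cdot> ((Uh a c \<cdot> VComp A a b c) \<otimes> p ?x a)" .
  qed (use ob in simp_all)
  ultimately show ?thesis
    by (simp add: vfunctor_def hom_def)
qed

text \<open>Here the equations are tested by composing on the left with the identity of \<open>\<A>(FX,FX)\<close> or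
  \<open>\<A>(FZ,FZ)\<close> and then applying \<open>\<pi>\<close>, which naturality transports to the laws of \<open>\<X>\<close>.\<close>

lemma natural_in_X_vfunctor:
  assumes nat: "natural_in_X Fh"
  shows "vfunctor V X A F Fh"
proof -
  note [simp] = natural_in_X_simps[OF nat]
  have "Fh x x \<cdot> VId X x = VId A (F x)" if ob: "x \<in> VOb X" for x
  proof (rule A.VComp_cancel_left[of "F x" "F x"])
    let ?I = "Ident V (VHom A (F x) (F x))"
    show "VComp A (F x) (F x) (F x) \<cdot> (?I \<otimes> (Fh x x \<cdot> VId X x))
      = VComp A (F x) (F x) (F x) \<cdot> (?I \<otimes> VId A (F x))"
    proof (rule iso_cancel_left[of "p x (F x)"])
      show "p x (F x) \<cdot> VComp A (F x) (F x) (F x) \<cdot> (?I \<otimes> (Fh x x \<cdot> VId X x))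
        = p x (F x) \<cdot> VComp A (F x) (F x) (F x) \<cdot> (?I \<otimes> VId A (F x))"
        using ob by (simp add: natural_in_X_Comp[OF nat] A.VComp_VId_right_Arr X.VComp_VId_right_Arr)
    qed (use ob in simp_all)
  qed (use ob in simp_all)
  moreover have "VComp A (F x) (F y) (F z) \<cdot> (Fh y z \<otimes> Fh x y) = Fh x z \<cdot> VComp X x y z"
    if ob: "x \<in> VOb X" "y \<in> VOb X" "z \<in> VOb X" for x y z
  proof (rule A.VComp_cancel_left[of "F x" "F z"])
    let ?a = "F z"
    let ?I = "Ident V (VHom A (F z) ?a)"
    let ?assoc = "assoc V (VHom A (F z) ?a) (VHom X y z) (VHom X x y)"
    let ?l = "VComp A (F x) (F z) ?a \<cdot> (?I \<otimes> (VComp A (F x) (F y) (F z) \<cdot> (Fh y z \<otimes> Fh x y)))"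
    let ?r = "VComp A (F x) (F z) ?a \<cdot> (?I \<otimes> (Fh x z \<cdot> VComp X x y z))"
    have "p x ?a \<cdot> ?l \<cdot> ?assoc
      = p x ?a \<cdot> VComp A (F x) (F y) ?a
          \<cdot> ((VComp A (F y) (F z) ?a \<cdot> (?I \<otimes> Fh y z)) \<otimes> (Fh x y \<cdot> Ident V (VHom X x y)))"
      using ob by (simp add: A.VComp_assoc_Arr)
    also have "\<dots> = VComp X x y (U ?a)
        \<cdot> ((p y ?a \<cdot> VComp A (F y) (F z) ?a \<cdot> (?I \<otimes> Fh y z)) \<otimes> Ident V (VHom X x y))"
      by (subst natural_in_X_Comp[OF nat]) (use ob in simp_all)
    also have "\<dots> = VComp X x y (U ?a)
        \<cdot> ((VComp X y z (U ?a) \<cdot> (p z ?a \<otimes> Ident V (VHom X y z))) \<otimes> Ident V (VHom X x y))"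
      using nat ob by (simp add: natural_in_X_def)
    also have "\<dots> = (VComp X x z (U ?a) \<cdot> ((p z ?a \<cdot> ?I) \<otimes> VComp X x y z)) \<cdot> ?assoc"
      using ob by (simp add: X.VComp_assoc_Arr)
    also have "\<dots> = (p x ?a \<cdot> ?r) \<cdot> ?assoc"
      by (subst natural_in_X_Comp[OF nat, symmetric]) (use ob in simp_all)
    finally have "(p x ?a \<cdot> ?l) \<cdot> ?assoc = (p x ?a \<cdot> ?r) \<cdot> ?assoc"
      using ob by simp
    then have "p x ?a \<cdot> ?l = p x ?a \<cdot> ?r"
      by (rule iso_cancel_right[rotated 5]) (use ob in simp_all)
    then show "?l = ?r"
      by (rule iso_cancel_left[rotated 5]) (use ob in simp_all)
  qed (use ob in simp_all)
  ultimately show ?thesis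
    by (simp add: vfunctor_def hom_def)
qed

text \<open>Naturality in \<open>A\<close> at \<open>j\<close> gives \<open>\<pi> = comp (Uh \<otimes> \<beta>) r\<^sup>-\<^sup>1\<close>; reassociating \<open>comp (\<pi> \<otimes> 1)\<close> then moves
  \<open>\<beta>\<close> onto the factor \<open>\<X>(X,Y)\<close>, where it forms \<open>\<pi> F\<^sub>X\<^sub>Y\<close>.\<close>

lemma natural_in_X_core_F:
  assumes nat: "natural_in_A Uh"
  shows "natural_in_X F\<^sub>c"
  unfolding natural_in_X_def
proof (intro conjI ballI)
  note [simp] = natural_in_A_simps[OF nat]
  fix a x y assume ob: "a \<in> VOb A" "x \<in> VOb X" "y \<in> VOb X"
  let ?I = "Ident V (VHom X x y)"
  let ?r = "inverse_arr V (runit V (VHom A (F y) a))"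
  let ?l = "inverse_arr V (lunit V (VHom X x y))"
  have p: "p y a = VComp X y (U (F y)) (U a) \<cdot> (Uh (F y) a \<otimes> \<beta> y) \<cdot> ?r"
  proof -
    have "p y a = (p y a \<cdot> VComp A (F y) (F y) a
        \<cdot> (Ident V (VHom A (F y) a) \<otimes> VId A (F y))) \<cdot> ?r"
      using ob by (simp add: A.VComp_VId_right)
    also have "\<dots> = VComp X y (U (F y)) (U a) \<cdot> (Uh (F y) a \<otimes> \<beta> y) \<cdot> ?r"
      using ob by (subst natural_in_A_Comp[OF nat]) (simp_all add: core_beta_def)
    finally show ?thesis .
  qed
  have "VComp X x y (U a) \<cdot> (p y a \<otimes> ?I)
      = VComp X x (U (F y)) (U a)
          \<cdot> (Uh (F y) a \<otimes> (VComp X x y (U (F y)) \<cdot> (\<beta> y \<otimes> ?I) \<cdot> ?l))"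
    unfolding p using X.VComp_assoc_Unit[of x y "U (F y)" "U a" ?I "\<beta> y" "Uh (F y) a"] ob
    by simp
  also have "\<dots> = VComp X x (U (F y)) (U a)
      \<cdot> ((Uh (F y) a \<cdot> Ident V (VHom A (F y) a)) \<otimes> (p x (F y) \<cdot> F\<^sub>c x y))"
    using ob by (simp add: core_F_def)
  also have "\<dots> = p x a \<cdot> VComp A (F x) (F y) a \<cdot> (Ident V (VHom A (F y) a) \<otimes> F\<^sub>c x y)"
    by (subst natural_in_A_Comp[OF nat]) (use ob in simp_all)
  finally show "VComp X x y (U a) \<cdot> (p y a \<otimes> ?I)
      = p x a \<cdot> VComp A (F x) (F y) a \<cdot> (Ident V (VHom A (F y) a) \<otimes> F\<^sub>c x y)" .
qed (simp add: hom_def)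

text \<open>Naturality in \<open>X\<close> shows that \<open>comp (\<alpha> \<otimes> Fh \<pi>) l\<^sup>-\<^sup>1\<close> is the identity of \<open>\<A>(FX,A)\<close>, that is,
  \<open>\<pi>\<^sup>-\<^sup>1\<close> is composition of \<open>\<alpha>\<close> with \<open>Fh\<close>.  In \<open>comp (U\<^sub>A\<^sub>B \<otimes> \<pi>)\<close> the \<open>\<alpha>\<close> inside \<open>U\<^sub>A\<^sub>B\<close> can be
  reassociated to produce exactly this composite.\<close>

lemma natural_in_A_core_U:
  assumes nat: "natural_in_X Fh"
  shows "natural_in_A U\<^sub>c"
  unfolding natural_in_A_def
proof (intro conjI ballI)
  note [simp] = natural_in_X_simps[OF nat]
  fix a b x assume ob: "a \<in> VOb A" "b \<in> VOb A" "x \<in> VOb X"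
  let ?I = "Ident V (VHom A a b)"
  let ?r = "inverse_arr V (runit V (VHom A a b))"
  let ?l = "inverse_arr V (lunit V (VHom A (F x) a))"
  let ?f = "Fh x (U a) \<cdot> p x a"
  have one: "VComp A (F x) (F (U a)) a \<cdot> (\<alpha> a \<otimes> ?f) \<cdot> ?l = Ident V (VHom A (F x) a)"
  proof (rule iso_cancel_left[of "p x a"])
    have "p x a \<cdot> VComp A (F x) (F (U a)) a \<cdot> (\<alpha> a \<otimes> ?f) \<cdot> ?l
        = (p x a \<cdot> VComp A (F x) (F (U a)) a \<cdot> (\<alpha> a \<otimes> ?f)) \<cdot> ?l"
      using ob by simp
    also have "\<dots> = (VComp X x (U a) (U a) \<cdot> (VId X (U a) \<otimes> p x a)) \<cdot> ?l"
      by (subst natural_in_X_Comp[OF nat]) (use ob in \<open>simp_all add: core_alpha_def\<close>)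
    also have "\<dots> = p x a \<cdot> Ident V (VHom A (F x) a)"
      using ob by (simp add: X.VComp_VId_left_Arr)
    finally show "p x a \<cdot> VComp A (F x) (F (U a)) a \<cdot> (\<alpha> a \<otimes> ?f) \<cdot> ?l
        = p x a \<cdot> Ident V (VHom A (F x) a)" .
  qed (use ob in simp_all)
  have "VComp X x (U a) (U b) \<cdot> (U\<^sub>c a b \<otimes> p x a)
      = VComp X x (U a) (U b)
          \<cdot> ((p (U a) b \<cdot> VComp A (F (U a)) a b \<cdot> (?I \<otimes> \<alpha> a) \<cdot> ?r) \<otimes> p x a)"
    by (simp add: core_U_def)
  also have "\<dots> = p x b \<cdot> VComp A (F x) (F (U a)) b
      \<cdot> ((VComp A (F (U a)) a b \<cdot> (?I \<otimes> \<alpha> a) \<cdot> ?r) \<otimes> ?f)"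
    by (subst natural_in_X_Comp[OF nat]) (use ob in simp_all)
  also have "\<dots> = p x b \<cdot> VComp A (F x) a b
      \<cdot> (?I \<otimes> (VComp A (F x) (F (U a)) a \<cdot> (\<alpha> a \<otimes> ?f) \<cdot> ?l))"
    using A.VComp_assoc_Unit[of "F x" "F (U a)" a b ?f "\<alpha> a" ?I] ob by simp
  also have "\<dots> = p x b \<cdot> VComp A (F x) a b"
    unfolding one using ob by simp
  finally show "VComp X x (U a) (U b) \<cdot> (U\<^sub>c a b \<otimes> p x a) = p x b \<cdot> VComp A (F x) a b" .
qed (simp add: hom_def)

section \<open>Adjunctions as pairs of natural families\<close>

lemma adjunction_iff_natural:
  "adjunction V A X U Uh F Fh p \<longleftrightarrow> natural_in_A Uh \<and> natural_in_X Fh"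
proof
  assume "adjunction V A X U Uh F Fh p"
  then show "natural_in_A Uh \<and> natural_in_X Fh"
    by (simp add: adjunction_def vfunctor_def natural_in_A_def natural_in_X_def)
next
  assume "natural_in_A Uh \<and> natural_in_X Fh"
  then show "adjunction V A X U Uh F Fh p"
    using natural_in_A_vfunctor[of Uh] natural_in_X_vfunctor[of Fh]
    by (simp add: adjunction_def natural_in_A_def natural_in_X_def hom_def)
qed

lemma natural_in_A_core_U_iff:
  "natural_in_A U\<^sub>c \<longleftrightarrow>
    (\<forall>a\<in>VOb A. \<forall>b\<in>VOb A. \<forall>x\<in>VOb X.
       VComp X x (U a) (U b) \<cdot> (U\<^sub>c a b \<otimes> p x a) = p x b \<cdot> VComp A (F x) a b)"
  by (simp add: natural_in_A_def hom_def)

text \<open>Condition (II) is naturality in \<open>X\<close> conjugated by \<open>\<pi>\<close>: apply \<open>\<pi>\<^sup>-\<^sup>1\<close> after both sides and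
  \<open>\<pi>\<^sup>-\<^sup>1 \<otimes> 1\<close> before them.\<close>

lemma natural_in_X_core_F_iff:
  "natural_in_X F\<^sub>c \<longleftrightarrow>
    (\<forall>a\<in>VOb A. \<forall>x\<in>VOb X. \<forall>y\<in>VOb X.
       VComp A (F x) (F y) a \<cdot> (inverse_arr V (p y a) \<otimes> F\<^sub>c x y)
       = inverse_arr V (p x a) \<cdot> VComp X x y (U a))"
proof -
  have "VComp X x y (U a) \<cdot> (p y a \<otimes> Ident V (VHom X x y))
        = p x a \<cdot> VComp A (F x) (F y) a \<cdot> (Ident V (VHom A (F y) a) \<otimes> F\<^sub>c x y)
      \<longleftrightarrow> VComp A (F x) (F y) a \<cdot> (inverse_arr V (p y a) \<otimes> F\<^sub>c x y)
        = inverse_arr V (p x a) \<cdot> VComp X x y (U a)"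
      (is "?n \<cdot> ?p = ?q \<longleftrightarrow> ?m = ?k")
    if ob: "a \<in> VOb A" "x \<in> VOb X" "y \<in> VOb X" for a x y
  proof
    assume eq: "?n \<cdot> ?p = ?q"
    have "?k = inverse_arr V (p x a) \<cdot> (?n \<cdot> ?p) \<cdot> (inverse_arr V (p y a) \<otimes> Ident V (VHom X x y))"
      using ob by simp
    then show "?m = ?k"
      unfolding eq using ob by simp
  next
    assume eq: "?m = ?k"
    have "?q = p x a \<cdot> ?m \<cdot> ?p"
      using ob by simp
    then show "?n \<cdot> ?p = ?q"
      unfolding eq using ob by simp
  qed
  then show ?thesis
    by (simp add: natural_in_X_def hom_def)
qed

end

theorem theorem2:
  fixes V :: "('o, 'm) monoidal_category"
    and A :: "('a, 'o, 'm) vcategory"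
    and X :: "('x, 'o, 'm) vcategory"
    and U :: "'a \<Rightarrow> 'x" and F :: "'x \<Rightarrow> 'a"
    and p :: "'x \<Rightarrow> 'a \<Rightarrow> 'm"
  assumes "monoidal_category V"
    and "vcategory V A"
    and "vcategory V X"
    and "adjunction_core V A X U F p"
  shows "((\<exists>Uh Fh. adjunction V A X U Uh F Fh p) \<longleftrightarrow>
            (\<forall>a\<in>VOb A. \<forall>b\<in>VOb A. \<forall>x\<in>VOb X.
               VComp X x (U a) (U b) \<cdot>\<^bsub>V\<^esub> (core_U V A X U F p a b \<otimes>\<^bsub>V\<^esub> p x a)
               = p x b \<cdot>\<^bsub>V\<^esub> VComp A (F x) a b)
          \<or> (\<forall>a\<in>VOb A. \<forall>x\<in>VOb X. \<forall>y\<in>VOb X.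
               VComp A (F x) (F y) a
                 \<cdot>\<^bsub>V\<^esub> (inverse_arr V (p y a) \<otimes>\<^bsub>V\<^esub> core_F V A X U F p x y)
               = inverse_arr V (p x a) \<cdot>\<^bsub>V\<^esub> VComp X x y (U a)))
       \<and> (\<forall>Uh Fh Uh' Fh'.
            adjunction V A X U Uh F Fh p \<and> adjunction V A X U Uh' F Fh' p \<longrightarrow>
              (\<forall>a\<in>VOb A. \<forall>b\<in>VOb A. Uh a b = Uh' a b)
              \<and> (\<forall>x\<in>VOb X. \<forall>y\<in>VOb X. Fh x y = Fh' x y))"
proof -
  interpret core_of_adjunction V A X U F p
    using assms by (simp add: core_of_adjunction_def core_of_adjunction_axioms_def)
  show ?thesis
    unfolding natural_in_A_core_U_iff[symmetric] natural_in_X_core_F_iff[symmetric]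
      adjunction_iff_natural
  proof (intro conjI iffI allI impI)
    assume "\<exists>Uh Fh. natural_in_A Uh \<and> natural_in_X Fh"
    then show "natural_in_A U\<^sub>c \<or> natural_in_X F\<^sub>c"
      using natural_in_A_core_U by blast
  next
    assume "natural_in_A U\<^sub>c \<or> natural_in_X F\<^sub>c"
    then show "\<exists>Uh Fh. natural_in_A Uh \<and> natural_in_X Fh"
      using natural_in_A_core_U natural_in_X_core_F by blast
  qed (use natural_in_A_unique natural_in_X_unique in metis)+
qed

end
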